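(* Let $(A,1,\Delta,\varepsilon)$ be a weak bialgebra and $S:A\to A$ a bialgebra anti-automorphism. Assume there exists a nondegenerate $\lambda\in\hat A=\mathrm{Hom}_K(A,K)$ satisfying $$a_{(1)}\lambda(ba_{(2)})=S(b_{(1)})\lambda(b_{(2)}a)\qquad\text{for all }a,b\in A.$$ Then $S$ is an antipode and $A$ is a weak Hopf algebra.
   Context: $K$ is a field and all spaces are finite dimensional over $K$. A weak bialgebra $(A,1,\Delta,\varepsilon)$ is a unital associative $K$-algebra $(A,1)$ which is also a coassociative coalgebra with coproduct $\Delta$ and counit $\varepsilon$, such that $\Delta(ab)=\Delta(a)\Delta(b)$ for all $a,b$; neither $\Delta(1)=1\otimes1$ nor multiplicativity of $\varepsilon$ is required. Sweedler notation is used. A bialgebra anti-automorphism is a linear bijection $S$ with $S(ab)=S(b)S(a)$ and $\Delta(S(a))=S(a_{(2)})\otimes S(a_{(1)})$. A functional $\lambda$ on $A$ is nondegenerate if the bilinear form $(a,b)\mapsto\lambda(ab)$ is nondegenerate. An antipode is a linear map $S:A\to A$ with $a_{(1)}S(a_{(2)})=\varepsilon(1_{(1)}a)1_{(2)}$, $S(a_{(1)})a_{(2)}=1_{(1)}\varepsilon(a1_{(2)})$ and $S(a_{(1)})a_{(2)}S(a_{(3)})=S(a)$ for all $a\in A$. A weak Hopf algebra is a weak bialgebra with antipode which is bimonoidal, i.e. $\varepsilon(abc)=\varepsilon(ab_{(1)})\varepsilon(b_{(2)}c)=\varepsilon(ab_{(2)})\varepsilon(b_{(1)}c)$ for all $a,b,c\in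 A$ and $(\Delta(1)\otimes1)(1\otimes\Delta(1))=1_{(1)}\otimes1_{(2)}\otimes1_{(3)}=(1\otimes\Delta(1))(\Delta(1)\otimes1)$. *)

theory Defs
  imports Complex_Main
begin

text \<open>
  An element of \<open>A \<otimes> A\<close> is a class of formal sums \<open>\<Sum>i. x\<^sub>i \<otimes> y\<^sub>i\<close>, written as lists of
  pairs \<open>(x\<^sub>i, y\<^sub>i)\<close>, modulo the congruence generated by the bilinearity relations; likewise for
  \<open>A \<otimes> A \<otimes> A\<close>, with lists of triples.  The parameter \<open>s\<close> is the scalar multiplication of \<open>A\<close>.
  Formal sums are a monoid, not a group, under concatenation, hence the explicit rules \<open>zero\<close>.
\<close>

inductive tensor2_eq ::
  "('k::field \<Rightarrow> 'a::ab_group_add \<Rightarrow> 'a) \<Rightarrow> ('a \<times> 'a) list \<Rightarrow> ('a \<times> 'a) list \<Rightarrow> bool"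
  for s where
  refl: "tensor2_eq s xs xs"
| sym: "tensor2_eq s xs ys \<Longrightarrow> tensor2_eq s ys xs"
| trans: "tensor2_eq s xs ys \<Longrightarrow> tensor2_eq s ys zs \<Longrightarrow> tensor2_eq s xs zs"
| append: "tensor2_eq s xs xs' \<Longrightarrow> tensor2_eq s ys ys' \<Longrightarrow> tensor2_eq s (xs @ ys) (xs' @ ys')"
| comm: "tensor2_eq s (xs @ ys) (ys @ xs)"
| add1: "tensor2_eq s [(x + x', y)] [(x, y), (x', y)]"
| add2: "tensor2_eq s [(x, y + y')] [(x, y), (x, y')]"
| scale: "tensor2_eq s [(s k x, y)] [(x, s k y)]"
| zero: "tensor2_eq s [(0, y)] []"

inductive tensor3_eq ::
  "('k::field \<Rightarrow> 'a::ab_group_add \<Rightarrow> 'a) \<Rightarrow> ('a \<times> 'a \<times> 'a) list \<Rightarrow> ('a \<times> 'a \<times> 'a) list \<Rightarrow> bool"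
  for s where
  refl: "tensor3_eq s xs xs"
| sym: "tensor3_eq s xs ys \<Longrightarrow> tensor3_eq s ys xs"
| trans: "tensor3_eq s xs ys \<Longrightarrow> tensor3_eq s ys zs \<Longrightarrow> tensor3_eq s xs zs"
| append: "tensor3_eq s xs xs' \<Longrightarrow> tensor3_eq s ys ys' \<Longrightarrow> tensor3_eq s (xs @ ys) (xs' @ ys')"
| comm: "tensor3_eq s (xs @ ys) (ys @ xs)"
| add1: "tensor3_eq s [(x + x', y, z)] [(x, y, z), (x', y, z)]"
| add2: "tensor3_eq s [(x, y + y', z)] [(x, y, z), (x, y', z)]"
| add3: "tensor3_eq s [(x, y, z + z')] [(x, y, z), (x, y, z')]"
| scale12: "tensor3_eq s [(s k x, y, z)] [(x, s k y, z)]"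
| scale23: "tensor3_eq s [(x, s k y, z)] [(x, y, s k z)]"
| zero: "tensor3_eq s [(0, y, z)] []"

type_synonym 'a tensor2 = "('a \<times> 'a) list set"
type_synonym 'a tensor3 = "('a \<times> 'a \<times> 'a) list set"

definition tens2 ::
  "('k::field \<Rightarrow> 'a::ab_group_add \<Rightarrow> 'a) \<Rightarrow> ('a \<times> 'a) list \<Rightarrow> 'a tensor2" where
  "tens2 s xs = {ys. tensor2_eq s xs ys}"

definition tens3 ::
  "('k::field \<Rightarrow> 'a::ab_group_add \<Rightarrow> 'a) \<Rightarrow> ('a \<times> 'a \<times> 'a) list \<Rightarrow> 'a tensor3" where
  "tens3 s xs = {ys. tensor3_eq s xs ys}"

definition tensor2_space ::
  "('k::field \<Rightarrow> 'a::ab_group_add \<Rightarrow> 'a) \<Rightarrow> 'a tensor2 set" where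
  "tensor2_space s = range (tens2 s)"

text \<open>
  Sweedler notation: \<open>(x, y) \<leftarrow> rep (\<Delta> a)\<close> is \<open>x = a\<^bsub>(1)\<^esub>\<close>, \<open>y = a\<^bsub>(2)\<^esub>\<close>.  It is only used
  inside expressions that are multilinear, so the choice of representative is immaterial
  (see \<open>sweedler2_cong\<close> and \<open>sweedler3_cong\<close> below).
\<close>

definition rep :: "'x list set \<Rightarrow> 'x list" where
  "rep t = (SOME xs. xs \<in> t)"

definition tensor2_add ::
  "('k::field \<Rightarrow> 'a::ab_group_add \<Rightarrow> 'a) \<Rightarrow> 'a tensor2 \<Rightarrow> 'a tensor2 \<Rightarrow> 'a tensor2" where
  "tensor2_add s t u = tens2 s (rep t @ rep u)"

definition tensor2_scale ::
  "('k::field \<Rightarrow> 'a::ab_group_add \<Rightarrow> 'a) \<Rightarrow> 'k \<Rightarrow> 'a tensor2 \<Rightarrow> 'a tensor2" where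
  "tensor2_scale s k t = tens2 s [(s k x, y). (x, y) \<leftarrow> rep t]"

definition tensor2_mult ::
  "('k::field \<Rightarrow> 'a::ring \<Rightarrow> 'a) \<Rightarrow> 'a tensor2 \<Rightarrow> 'a tensor2 \<Rightarrow> 'a tensor2" where
  "tensor2_mult s t u =
     tens2 s [(x * x', y * y'). (x, y) \<leftarrow> rep t, (x', y') \<leftarrow> rep u]"

definition tensor3_mult ::
  "('k::field \<Rightarrow> 'a::ring \<Rightarrow> 'a) \<Rightarrow> 'a tensor3 \<Rightarrow> 'a tensor3 \<Rightarrow> 'a tensor3" where
  "tensor3_mult s t u =
     tens3 s [(x * x', y * y', z * z'). (x, y, z) \<leftarrow> rep t, (x', y', z') \<leftarrow> rep u]"

text \<open>\<open>\<Delta> \<otimes> id\<close> and \<open>id \<otimes> \<Delta>\<close>, as maps from \<open>A \<otimes> A\<close> to \<open>A \<otimes> A \<otimes> A\<close>.\<close>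

definition comult_id ::
  "('k::field \<Rightarrow> 'a::ab_group_add \<Rightarrow> 'a) \<Rightarrow> ('a \<Rightarrow> 'a tensor2) \<Rightarrow> 'a tensor2 \<Rightarrow> 'a tensor3" where
  "comult_id s \<Delta> t = tens3 s [(u, v, y). (x, y) \<leftarrow> rep t, (u, v) \<leftarrow> rep (\<Delta> x)]"

definition id_comult ::
  "('k::field \<Rightarrow> 'a::ab_group_add \<Rightarrow> 'a) \<Rightarrow> ('a \<Rightarrow> 'a tensor2) \<Rightarrow> 'a tensor2 \<Rightarrow> 'a tensor3" where
  "id_comult s \<Delta> t = tens3 s [(x, u, v). (x, y) \<leftarrow> rep t, (u, v) \<leftarrow> rep (\<Delta> y)]"

definition comult2 ::
  "('k::field \<Rightarrow> 'a::ab_group_add \<Rightarrow> 'a) \<Rightarrow> ('a \<Rightarrow> 'a tensor2) \<Rightarrow> 'a \<Rightarrow> 'a tensor3" where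
  "comult2 s \<Delta> a = comult_id s \<Delta> (\<Delta> a)"

text \<open>
  The sort \<open>{ring, monoid_mult}\<close> is that of unital associative rings in which \<open>1 = 0\<close> is allowed
  (in contrast to \<open>ring_1\<close>).
\<close>

locale fd_algebra = vector_space s
  for s :: "'k::field \<Rightarrow> 'a::{ring, monoid_mult} \<Rightarrow> 'a" +
  assumes finite_dim: "\<exists>B. finite B \<and> span B = UNIV"
    and scale_mult_left: "s k a * b = s k (a * b)"
    and scale_mult_right: "a * s k b = s k (a * b)"

locale coalgebra = vector_space s
  for s :: "'k::field \<Rightarrow> 'a::ab_group_add \<Rightarrow> 'a" +
  fixes \<Delta> :: "'a \<Rightarrow> 'a tensor2" and \<epsilon> :: "'a \<Rightarrow> 'k"
  assumes comult_in: "\<Delta> a \<in> tensor2_space s"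
    and comult_add: "\<Delta> (a + b) = tensor2_add s (\<Delta> a) (\<Delta> b)"
    and comult_scale: "\<Delta> (s k a) = tensor2_scale s k (\<Delta> a)"
    and counit_linear: "Vector_Spaces.linear s (*) \<epsilon>"
    and coassoc: "comult_id s \<Delta> (\<Delta> a) = id_comult s \<Delta> (\<Delta> a)"
    and counit_left: "(\<Sum>(a1, a2) \<leftarrow> rep (\<Delta> a). s (\<epsilon> a1) a2) = a"
    and counit_right: "(\<Sum>(a1, a2) \<leftarrow> rep (\<Delta> a). s (\<epsilon> a2) a1) = a"

locale weak_bialgebra = fd_algebra s + coalgebra s \<Delta> \<epsilon>
  for s :: "'k::field \<Rightarrow> 'a::{ring, monoid_mult} \<Rightarrow> 'a"
    and \<Delta> :: "'a \<Rightarrow> 'a tensor2" and \<epsilon> :: "'a \<Rightarrow> 'k" +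
  assumes comult_mult: "\<Delta> (a * b) = tensor2_mult s (\<Delta> a) (\<Delta> b)"

definition bialgebra_anti_automorphism ::
  "('k::field \<Rightarrow> 'a::ring \<Rightarrow> 'a) \<Rightarrow> ('a \<Rightarrow> 'a tensor2) \<Rightarrow> ('a \<Rightarrow> 'a) \<Rightarrow> bool" where
  "bialgebra_anti_automorphism s \<Delta> S \<longleftrightarrow>
     Vector_Spaces.linear s s S \<and> bij S \<and>
     (\<forall>a b. S (a * b) = S b * S a) \<and>
     (\<forall>a. \<Delta> (S a) = tens2 s [(S a2, S a1). (a1, a2) \<leftarrow> rep (\<Delta> a)])"

definition nondegenerate :: "('a::ring \<Rightarrow> 'k::field) \<Rightarrow> bool" where
  "nondegenerate l \<longleftrightarrow>
     (\<forall>a. (\<forall>b. l (a * b) = 0) \<longrightarrow> a = 0) \<and> (\<forall>b. (\<forall>a. l (a * b) = 0) \<longrightarrow> b = 0)"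

definition antipode ::
  "('k::field \<Rightarrow> 'a::{ring, monoid_mult} \<Rightarrow> 'a) \<Rightarrow> ('a \<Rightarrow> 'a tensor2) \<Rightarrow> ('a \<Rightarrow> 'k) \<Rightarrow>
     ('a \<Rightarrow> 'a) \<Rightarrow> bool" where
  "antipode s \<Delta> \<epsilon> S \<longleftrightarrow>
     Vector_Spaces.linear s s S \<and>
     (\<forall>a. (\<Sum>(a1, a2) \<leftarrow> rep (\<Delta> a). a1 * S a2) =
          (\<Sum>(u1, u2) \<leftarrow> rep (\<Delta> 1). s (\<epsilon> (u1 * a)) u2)) \<and>
     (\<forall>a. (\<Sum>(a1, a2) \<leftarrow> rep (\<Delta> a). S a1 * a2) =
          (\<Sum>(u1, u2) \<leftarrow> rep (\<Delta> 1). s (\<epsilon> (a * u2)) u1)) \<and>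
     (\<forall>a. (\<Sum>(a1, a2, a3) \<leftarrow> rep (comult2 s \<Delta> a). S a1 * a2 * S a3) = S a)"

definition bimonoidal ::
  "('k::field \<Rightarrow> 'a::{ring, monoid_mult} \<Rightarrow> 'a) \<Rightarrow> ('a \<Rightarrow> 'a tensor2) \<Rightarrow> ('a \<Rightarrow> 'k) \<Rightarrow> bool" where
  "bimonoidal s \<Delta> \<epsilon> \<longleftrightarrow>
     (\<forall>a b c. \<epsilon> (a * b * c) = (\<Sum>(b1, b2) \<leftarrow> rep (\<Delta> b). \<epsilon> (a * b1) * \<epsilon> (b2 * c))) \<and>
     (\<forall>a b c. \<epsilon> (a * b * c) = (\<Sum>(b1, b2) \<leftarrow> rep (\<Delta> b). \<epsilon> (a * b2) * \<epsilon> (b1 * c))) \<and>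
     (let E1 = tens3 s [(u, v, 1). (u, v) \<leftarrow> rep (\<Delta> 1)];
          E2 = tens3 s [(1, u, v). (u, v) \<leftarrow> rep (\<Delta> 1)]
      in tensor3_mult s E1 E2 = comult2 s \<Delta> 1 \<and> comult2 s \<Delta> 1 = tensor3_mult s E2 E1)"

definition weak_Hopf_algebra ::
  "('k::field \<Rightarrow> 'a::{ring, monoid_mult} \<Rightarrow> 'a) \<Rightarrow> ('a \<Rightarrow> 'a tensor2) \<Rightarrow> ('a \<Rightarrow> 'k) \<Rightarrow> bool" where
  "weak_Hopf_algebra s \<Delta> \<epsilon> \<longleftrightarrow>
     weak_bialgebra s \<Delta> \<epsilon> \<and> (\<exists>S. antipode s \<Delta> \<epsilon> S) \<and> bimonoidal s \<Delta> \<epsilon>"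

lemma tens2_eq_iff: "tens2 s xs = tens2 s ys \<longleftrightarrow> tensor2_eq s xs ys"
  unfolding tens2_def by (blast intro: tensor2_eq.refl tensor2_eq.sym tensor2_eq.trans)

lemma tens3_eq_iff: "tens3 s xs = tens3 s ys \<longleftrightarrow> tensor3_eq s xs ys"
  unfolding tens3_def by (blast intro: tensor3_eq.refl tensor3_eq.sym tensor3_eq.trans)

lemma tensor2_eq_rep: "tensor2_eq s xs (rep (tens2 s xs))"
  using someI[of "\<lambda>ys. ys \<in> tens2 s xs" xs] by (simp add: rep_def tens2_def tensor2_eq.refl)

lemma tensor3_eq_rep: "tensor3_eq s xs (rep (tens3 s xs))"
  using someI[of "\<lambda>ys. ys \<in> tens3 s xs" xs] by (simp add: rep_def tens3_def tensor3_eq.refl)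

lemma sweedler2_cong:
  fixes F :: "'a::ab_group_add \<Rightarrow> 'a \<Rightarrow> 'b::ab_group_add"
  assumes "tensor2_eq s xs ys"
    and "\<And>x x' y. F (x + x') y = F x y + F x' y" "\<And>x y y'. F x (y + y') = F x y + F x y'"
    and "\<And>k x y. F (s k x) y = F x (s k y)"
  shows "(\<Sum>(x, y) \<leftarrow> xs. F x y) = (\<Sum>(x, y) \<leftarrow> ys. F x y)"
proof -
  have "F 0 y = 0" for y
    using assms(2)[of 0 0 y] by simp
  with assms show ?thesis
    by (induction rule: tensor2_eq.induct) (simp_all add: add.commute)
qed

lemma sweedler3_cong:
  fixes F :: "'a::ab_group_add \<Rightarrow> 'a \<Rightarrow> 'a \<Rightarrow> 'b::ab_group_add"
  assumes "tensor3_eq s xs ys"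
    and "\<And>x x' y z. F (x + x') y z = F x y z + F x' y z"
    and "\<And>x y y' z. F x (y + y') z = F x y z + F x y' z"
    and "\<And>x y z z'. F x y (z + z') = F x y z + F x y z'"
    and "\<And>k x y z. F (s k x) y z = F x (s k y) z" "\<And>k x y z. F x (s k y) z = F x y (s k z)"
  shows "(\<Sum>(x, y, z) \<leftarrow> xs. F x y z) = (\<Sum>(x, y, z) \<leftarrow> ys. F x y z)"
proof -
  have "F 0 y z = 0" for y z
    using assms(2)[of 0 0 y z] by simp
  with assms show ?thesis
    by (induction rule: tensor3_eq.induct) (simp_all add: add.commute)
qed

end

theory Submission
  imports Defs
begin

text \<open>
  By nondegeneracy there is \<open>r\<close> with \<open>\<lambda>(ar) = \<epsilon>(a)\<close>, and the hypothesis turns into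
  \<open>S(b) = r\<^sub>1 \<lambda>(br\<^sub>2)\<close>, hence \<open>r\<^sub>1 \<otimes> ar\<^sub>2 = S(a)r\<^sub>1 \<otimes> r\<^sub>2\<close>, which is the same hypothesis for the dual of
  \<open>A\<close> with \<open>r\<close> in the role of \<open>\<lambda>\<close>.  With \<open>b = S\<^sup>-\<^sup>1(r)c\<close> and with \<open>a = cr\<close> the hypothesis gives
  \<open>S(c\<^sub>1)c\<^sub>2a = a\<^sub>1\<epsilon>(ca\<^sub>2)\<close> and \<open>c\<^sub>1S(c\<^sub>2)S(b) = S(b\<^sub>1)\<epsilon>(b\<^sub>2c)\<close>; these yield the axioms on
  \<open>\<epsilon>\<close> and two of the antipode axioms.  The dual identities \<open>S(a\<^sub>1)a\<^sub>2 \<otimes> a\<^sub>3 = 1\<^sub>1 \<otimes> a1\<^sub>2\<close> and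
  \<open>S(a\<^sub>3) \<otimes> a\<^sub>1S(a\<^sub>2) = S(a)1\<^sub>1 \<otimes> 1\<^sub>2\<close> yield the axioms on \<open>\<Delta>\<^sup>2(1)\<close>.  The axiom on
  \<open>a\<^sub>1S(a\<^sub>2)\<close> needs both kinds.

  Identities between tensors are stated by evaluating both sides at all multilinear scalar forms;
  these separate tensors, and no choice of representatives has to be tracked.
\<close>

section \<open>Multilinear forms and tensors\<close>

lemma sum_list_map_concat:
  "sum_list (map f (concat xss)) = (\<Sum>xs\<leftarrow>xss. sum_list (map f xs))"
  by (induction xss) auto

lemma vector_space_field: "vector_space ((*) :: 'k::field \<Rightarrow> 'k \<Rightarrow> 'k)"
  by unfold_locales (simp_all add: algebra_simps)

section \<open>Formal sums indexed by lists, up to congruence\<close>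

lemma tensor3_eq_concat_cong:
  assumes "\<And>i. tensor3_eq s (f i) (g i)"
  shows "tensor3_eq s (concat (map f I)) (concat (map g I))"
  by (induction I) (auto intro: tensor3_eq.intros assms)

lemma tensor3_eq_concat_append:
  assumes "\<And>i. tensor3_eq s (f i @ g i) (h i)"
  shows "tensor3_eq s (concat (map f I) @ concat (map g I)) (concat (map h I))"
proof (induction I)
  case (Cons i I)
  let ?F = "concat (map f I)" and ?G = "concat (map g I)"
  \<comment> \<open>Concatenation commutes only up to \<open>tensor3_eq\<close>, so
    \<open>g i\<close> has to be carried past \<open>?F\<close> explicitly.\<close>
  have "tensor3_eq s ((f i @ (?F @ g i)) @ ?G) ((f i @ (g i @ ?F)) @ ?G)"
    by (intro tensor3_eq.append tensor3_eq.comm tensor3_eq.refl)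
  moreover have "tensor3_eq s ((f i @ g i) @ (?F @ ?G)) (h i @ concat (map h I))"
    by (intro tensor3_eq.append assms Cons.IH)
  ultimately show ?case
    by (auto intro: tensor3_eq.trans)
qed (simp add: tensor3_eq.refl)

lemma tensor3_eq_concat_Nil:
  assumes "\<And>i. tensor3_eq s (f i) []"
  shows "tensor3_eq s (concat (map f I)) []"
proof (induction I)
  case (Cons i I)
  then show ?case
    using tensor3_eq.append[OF assms Cons.IH] by simp
qed (simp add: tensor3_eq.refl)

section \<open>Linear, bilinear and trilinear forms on a finite-dimensional algebra\<close>

context fd_algebra
begin

abbreviation lform :: "('a \<Rightarrow> 'k) \<Rightarrow> bool" where
  "lform \<equiv> Vector_Spaces.linear s (*)"

abbreviation lmap :: "('a \<Rightarrow> 'a) \<Rightarrow> bool" where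
  "lmap \<equiv> Vector_Spaces.linear s s"

lemma lform_iff:
  fixes f :: "'a \<Rightarrow> 'k"
  shows "lform f \<longleftrightarrow> (\<forall>x y. f (x + y) = f x + f y) \<and> (\<forall>k x. f (s k x) = k * f x)"
  by (simp add: Vector_Spaces.linear_iff vector_space_axioms vector_space_field)

lemma lmap_iff:
  "lmap f \<longleftrightarrow> (\<forall>x y. f (x + y) = f x + f y) \<and> (\<forall>k x. f (s k x) = s k (f x))"
  by (simp add: Vector_Spaces.linear_iff vector_space_axioms)

lemma lform_0: "lform f \<Longrightarrow> f 0 = 0"
  using lform_iff[of f] by (metis add_cancel_left_left)

lemma lform_sum_list: "lform f \<Longrightarrow> f (sum_list xs) = (\<Sum>x\<leftarrow>xs. f x)"
  by (induction xs) (auto simp: lform_0 lform_iff)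

lemma lform_sum: "lform f \<Longrightarrow> f (sum g I) = (\<Sum>i\<in>I. f (g i))"
  by (induction I rule: infinite_finite_induct) (auto simp: lform_0 lform_iff)

definition bform :: "('a \<Rightarrow> 'a \<Rightarrow> 'k) \<Rightarrow> bool" where
  "bform F \<longleftrightarrow> (\<forall>y. lform (\<lambda>x. F x y)) \<and> (\<forall>x. lform (\<lambda>y. F x y))"

definition tform :: "('a \<Rightarrow> 'a \<Rightarrow> 'a \<Rightarrow> 'k) \<Rightarrow> bool" where
  "tform F \<longleftrightarrow> (\<forall>y z. lform (\<lambda>x. F x y z)) \<and> (\<forall>x z. lform (\<lambda>y. F x y z)) \<and>
     (\<forall>x y. lform (\<lambda>z. F x y z))"

lemma bformI: "(\<And>y. lform (\<lambda>x. F x y)) \<Longrightarrow> (\<And>x. lform (\<lambda>y. F x y)) \<Longrightarrow> bform F"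
  by (simp add: bform_def)

lemma tformI:
  "(\<And>y z. lform (\<lambda>x. F x y z)) \<Longrightarrow> (\<And>x z. lform (\<lambda>y. F x y z)) \<Longrightarrow>
   (\<And>x y. lform (\<lambda>z. F x y z)) \<Longrightarrow> tform F"
  by (simp add: tform_def)

lemma lform_mult: "lform f \<Longrightarrow> lform (\<lambda>x. c * f x)" "lform f \<Longrightarrow> lform (\<lambda>x. f x * c)"
  by (auto simp: lform_iff algebra_simps)

lemma lform_comp: "lform f \<Longrightarrow> lmap g \<Longrightarrow> lform (\<lambda>x. f (g x))"
  by (auto simp: lform_iff lmap_iff)

lemma bform_comp:
  "bform F \<Longrightarrow> lmap g \<Longrightarrow> lform (\<lambda>x. F (g x) c)"
  "bform F \<Longrightarrow> lmap g \<Longrightarrow> lform (\<lambda>x. F c (g x))"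
  by (auto simp: bform_def lform_iff lmap_iff)

lemma tform_comp:
  "tform F \<Longrightarrow> lmap g \<Longrightarrow> lform (\<lambda>x. F (g x) c d)"
  "tform F \<Longrightarrow> lmap g \<Longrightarrow> lform (\<lambda>x. F c (g x) d)"
  "tform F \<Longrightarrow> lmap g \<Longrightarrow> lform (\<lambda>x. F c d (g x))"
  by (auto simp: tform_def lform_iff lmap_iff)

lemma lmap_ident: "lmap (\<lambda>x. x)"
  by (simp add: lmap_iff)

lemma lmap_comp: "lmap f \<Longrightarrow> lmap g \<Longrightarrow> lmap (\<lambda>x. f (g x))"
  by (auto simp: lmap_iff)

lemma bform_sum_cong:
  assumes "tensor2_eq s xs ys" "bform F"
  shows "(\<Sum>(x, y)\<leftarrow>xs. F x y) = (\<Sum>(x, y)\<leftarrow>ys. F x y)"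
  using assms(2) by (intro sweedler2_cong[OF assms(1)]) (auto simp: bform_def lform_iff)

lemma tform_sum_cong:
  assumes "tensor3_eq s xs ys" "tform F"
  shows "(\<Sum>(x, y, z)\<leftarrow>xs. F x y z) = (\<Sum>(x, y, z)\<leftarrow>ys. F x y z)"
  using assms(2) by (intro sweedler3_cong[OF assms(1)]) (auto simp: tform_def lform_iff)

text \<open>A basis inside a finite spanning set, with its coordinate functionals. It comes as a
  list because formal sums are lists.\<close>

lemma dual_basis:
  obtains bs :: "'a list" and \<kappa> :: "'a \<Rightarrow> 'a \<Rightarrow> 'k"
  where "distinct bs" "\<And>b. lform (\<kappa> b)" "\<And>x. (\<Sum>b\<leftarrow>bs. s (\<kappa> b x) b) = x"
    "\<And>b c. b \<in> set bs \<Longrightarrow> c \<in> set bs \<Longrightarrow> \<kappa> b c = (if b = c then 1 else 0)"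
    "independent (set bs)" "span (set bs) = UNIV"
proof -
  obtain C where C: "finite C" "span C = UNIV"
    using finite_dim by auto
  obtain B where B: "B \<subseteq> C" "independent B" "C \<subseteq> span B"
    using maximal_independent_subset[of C] by metis
  have "span B = UNIV"
    using B(3) C(2) span_mono[OF B(3)] by (simp add: span_span top.extremum_unique)
  have "finite B"
    using B(1) C(1) by (rule finite_subset)
  then obtain bs where bs: "set bs = B" "distinct bs"
    using finite_distinct_list by blast
  let ?\<kappa> = "\<lambda>b x. representation B x b"
  show ?thesis
  proof (rule that[of bs ?\<kappa>])
    show "lform (?\<kappa> b)" for b
      using \<open>independent B\<close> \<open>span B = UNIV\<close>
      by (simp add: lform_iff representation_add representation_scale)
    show "(\<Sum>b\<leftarrow>bs. s (?\<kappa> b x) b) = x" for x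
    proof -
      have "(\<Sum>b\<leftarrow>bs. s (?\<kappa> b x) b) = (\<Sum>b\<in>B. s (?\<kappa> b x) b)"
        using bs by (metis sum_list_distinct_conv_sum_set)
      also have "\<dots> = x"
        using \<open>independent B\<close> \<open>span B = UNIV\<close> \<open>finite B\<close> by (intro sum_representation_eq) auto
      finally show ?thesis .
    qed
    show "?\<kappa> b c = (if b = c then 1 else 0)" if "b \<in> set bs" "c \<in> set bs" for b c
      using representation_basis[OF \<open>independent B\<close>, of c] that bs by auto
  qed (use bs \<open>independent B\<close> \<open>span B = UNIV\<close> in auto)
qed

text \<open>Every formal sum is congruent to its expansion in a basis, and the coefficients of that
  expansion are values of trilinear forms, namely products of coordinate functionals. Sums on which
  all forms agree thus have the same expansion.\<close>

lemma tensor3_eqI: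
  assumes "\<And>F. tform F \<Longrightarrow> (\<Sum>(x, y, z)\<leftarrow>xs. F x y z) = (\<Sum>(x, y, z)\<leftarrow>ys. F x y z)"
  shows "tensor3_eq s xs ys"
proof -
  obtain bs \<kappa> where bs: "\<And>b. lform (\<kappa> b)" "\<And>x. (\<Sum>b\<leftarrow>bs. s (\<kappa> b x) b) = x"
    using dual_basis by metis
  note [trans] = tensor3_eq.trans
  \<comment> \<open>\<open>n k\<close> is the normal form with coefficients \<open>k\<close>, all
    scalars in the first slot and the basis triples in a fixed order; \<open>m ws\<close> collects
    the coefficients of \<open>ws\<close>. Equal coefficients make the normal forms equal as
    lists.\<close>
  define n where "n k = concat (map (\<lambda>b. concat (map (\<lambda>c. concat (map
      (\<lambda>d. [(s (k b c d) b, c, d)]) bs)) bs)) bs)" for k :: "'a \<Rightarrow> 'a \<Rightarrow> 'a \<Rightarrow> 'k"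
  define m where "m ws b c d = (\<Sum>(x, y, z)\<leftarrow>ws. \<kappa> b x * \<kappa> c y * \<kappa> d z)" for ws b c d
  \<comment> \<open>Only a zero in the first slot is a rule of the congruence; the other slots are
    reached by moving the scalar 0 across.\<close>
  have zero2: "tensor3_eq s [(x, 0, z)] []" for x z
    using tensor3_eq.scale12[of s 0 x 0 z] tensor3_eq.zero[of s 0 z]
    by (metis tensor3_eq.sym tensor3_eq.trans scale_zero_left)
  have zero3: "tensor3_eq s [(x, y, 0)] []" for x y
    using tensor3_eq.scale23[of s x 0 y 0] zero2
    by (metis tensor3_eq.sym tensor3_eq.trans scale_zero_left)
  have sum1: "tensor3_eq s [(sum_list (map f I), y, z)] (concat (map (\<lambda>i. [(f i, y, z)]) I))"
    for f :: "'a \<Rightarrow> 'a" and I y z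
  proof (induction I)
    case (Cons i I)
    have "tensor3_eq s [(f i + sum_list (map f I), y, z)]
        ([(f i, y, z)] @ [(sum_list (map f I), y, z)])"
      using tensor3_eq.add1[of s "f i"] by simp
    also have "tensor3_eq s \<dots> ([(f i, y, z)] @ concat (map (\<lambda>i. [(f i, y, z)]) I))"
      by (intro tensor3_eq.append tensor3_eq.refl Cons)
    finally show ?case by simp
  qed (simp add: tensor3_eq.zero)
  have sum2: "tensor3_eq s [(x, sum_list (map f I), z)] (concat (map (\<lambda>i. [(x, f i, z)]) I))"
    for f :: "'a \<Rightarrow> 'a" and I x z
  proof (induction I)
    case (Cons i I)
    have "tensor3_eq s [(x, f i + sum_list (map f I), z)]
        ([(x, f i, z)] @ [(x, sum_list (map f I), z)])"
      using tensor3_eq.add2[of s x "f i"] by simp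
    also have "tensor3_eq s \<dots> ([(x, f i, z)] @ concat (map (\<lambda>i. [(x, f i, z)]) I))"
      by (intro tensor3_eq.append tensor3_eq.refl Cons)
    finally show ?case by simp
  qed (simp add: zero2)
  have sum3: "tensor3_eq s [(x, y, sum_list (map f I))] (concat (map (\<lambda>i. [(x, y, f i)]) I))"
    for f :: "'a \<Rightarrow> 'a" and I x y
  proof (induction I)
    case (Cons i I)
    have "tensor3_eq s [(x, y, f i + sum_list (map f I))]
        ([(x, y, f i)] @ [(x, y, sum_list (map f I))])"
      using tensor3_eq.add3[of s x y "f i"] by simp
    also have "tensor3_eq s \<dots> ([(x, y, f i)] @ concat (map (\<lambda>i. [(x, y, f i)]) I))"
      by (intro tensor3_eq.append tensor3_eq.refl Cons)
    finally show ?case by simp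
  qed (simp add: zero3)
  have move: "tensor3_eq s [(s j x, s k y, s l z)] [(s (j * k * l) x, y, z)]" for j k l x y z
  proof -
    have "tensor3_eq s [(s j x, s k y, s l z)] [(s j x, s (l * k) y, z)]"
      using tensor3_eq.scale23[of s "s j x" l "s k y" z] by (simp add: tensor3_eq.sym)
    also have "tensor3_eq s \<dots> [(s (l * k) (s j x), y, z)]"
      by (rule tensor3_eq.sym[OF tensor3_eq.scale12])
    finally show ?thesis
      by (simp add: mult.commute mult.left_commute)
  qed
  have single: "tensor3_eq s [(x, y, z)] (n (m [(x, y, z)]))" for x y z
  proof -
    have "tensor3_eq s [(x, y, z)] (concat (map (\<lambda>b. [(s (\<kappa> b x) b, y, z)]) bs))"
      using sum1[of "\<lambda>b. s (\<kappa> b x) b" bs y z] by (simp only: bs)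
    also have "tensor3_eq s \<dots>
        (concat (map (\<lambda>b. concat (map (\<lambda>c. [(s (\<kappa> b x) b, s (\<kappa> c y) c, z)]) bs)) bs))"
      using sum2[of _ "\<lambda>b. s (\<kappa> b y) b" bs z]
      by (intro tensor3_eq_concat_cong) (simp only: bs)
    also have "tensor3_eq s \<dots> (concat (map (\<lambda>b. concat (map (\<lambda>c. concat (map (\<lambda>d.
        [(s (\<kappa> b x) b, s (\<kappa> c y) c, s (\<kappa> d z) d)]) bs)) bs)) bs))"
      using sum3[of _ _ "\<lambda>b. s (\<kappa> b z) b" bs]
      by (intro tensor3_eq_concat_cong) (simp only: bs)
    also have "tensor3_eq s \<dots> (n (m [(x, y, z)]))"
      unfolding n_def m_def by (intro tensor3_eq_concat_cong) (simp add: move)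
    finally show ?thesis .
  qed
  have n_add: "tensor3_eq s (n k @ n k') (n (\<lambda>b c d. k b c d + k' b c d))" for k k'
    unfolding n_def
    by (intro tensor3_eq_concat_append)
      (simp add: scale_left_distrib tensor3_eq.sym[OF tensor3_eq.add1])
  have normal: "tensor3_eq s ws (n (m ws))" for ws
  proof (induction ws)
    case Nil
    have "tensor3_eq s (n (m [])) []"
      unfolding n_def m_def
      by (intro tensor3_eq_concat_Nil) (simp add: tensor3_eq.zero)
    then show ?case by (rule tensor3_eq.sym)
  next
    case (Cons w ws)
    obtain x y z where w: "w = (x, y, z)" by (cases w)
    have "tensor3_eq s ([w] @ ws) (n (m [w]) @ n (m ws))"
      unfolding w by (intro tensor3_eq.append single Cons)
    also have "tensor3_eq s \<dots> (n (\<lambda>b c d. m [w] b c d + m ws b c d))"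
      by (rule n_add)
    also have "(\<lambda>b c d. m [w] b c d + m ws b c d) = m (w # ws)"
      by (simp add: m_def fun_eq_iff)
    finally show ?case by simp
  qed
  have "m xs = m ys"
    unfolding m_def fun_eq_iff
    by (intro allI assms tformI lform_mult bs)
  then show ?thesis
    using normal[of xs] normal[of ys] by (metis tensor3_eq.sym tensor3_eq.trans)
qed

text \<open>An injective map from \<open>A\<close> to its dual is onto because the dimensions
  agree.\<close>

lemma bform_represents:
  assumes F: "bform F" and nd: "\<And>x. (\<And>y. F x y = 0) \<Longrightarrow> x = 0" and g: "lform g"
  obtains x where "\<And>y. F x y = g y"
proof -
  obtain bs \<kappa> where bs: "distinct bs" "\<And>b. lform (\<kappa> b)" "\<And>x. (\<Sum>b\<leftarrow>bs. s (\<kappa> b x) b) = x"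
    "\<And>b c. b \<in> set bs \<Longrightarrow> c \<in> set bs \<Longrightarrow> \<kappa> b c = (if b = c then 1 else 0)"
    "independent (set bs)" "span (set bs) = UNIV"
    by (rule dual_basis) (rule that)
  interpret fin: finite_dimensional_vector_space s "set bs"
    by unfold_locales (use bs in auto)
  have expand: "f y = (\<Sum>b\<in>set bs. \<kappa> b y * f b)" if "lform f" for f y
  proof -
    have "f y = f (\<Sum>b\<in>set bs. s (\<kappa> b y) b)"
      using bs(1) bs(3)[of y] by (simp add: sum_list_distinct_conv_sum_set)
    then show ?thesis
      using that by (simp add: lform_sum[OF that]) (simp add: lform_iff)
  qed
  \<comment> \<open>The map to the dual, followed by the isomorphism of the dual with
    \<open>A\<close> that reads the values on the basis as coordinates. This makes it an
    endomorphism, for which injectivity gives surjectivity.\<close>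
  define \<phi> where "\<phi> x = (\<Sum>b\<in>set bs. s (F x b) b)" for x
  have coord: "\<kappa> c (\<Sum>b\<in>set bs. s (k b) b) = k c" if "c \<in> set bs" for c k
  proof -
    have "\<kappa> c (\<Sum>b\<in>set bs. s (k b) b) = (\<Sum>b\<in>set bs. k b * \<kappa> c b)"
      using bs(2)[of c] by (simp add: lform_sum[OF bs(2)]) (simp add: lform_iff)
    also have "\<dots> = (\<Sum>b\<in>set bs. if b = c then k b else 0)"
      using that bs(4) by (intro sum.cong) auto
    finally show ?thesis
      using that by simp
  qed
  have F_eq: "F x y = (\<Sum>b\<in>set bs. \<kappa> b y * F x b)" for x y
    using F by (intro expand) (simp add: bform_def)
  have lin: "lmap \<phi>"
    unfolding lmap_iff \<phi>_def using F
    by (simp add: bform_def lform_iff scale_left_distrib sum.distrib scale_sum_right)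
  have "inj \<phi>"
  proof -
    interpret \<phi>: Vector_Spaces.linear s s \<phi> by (rule lin)
    have "x = 0" if "\<phi> x = 0" for x
    proof (rule nd)
      have "F x b = 0" if "b \<in> set bs" for b
        using coord[OF that, of "F x"] \<open>\<phi> x = 0\<close> lform_0[OF bs(2)] by (simp add: \<phi>_def)
      then show "F x y = 0" for y
        by (subst F_eq) simp
    qed
    then show ?thesis
      by (simp add: \<phi>.inj_iff_eq_0)
  qed
  then have "surj \<phi>"
    using fin.linear_inj_imp_surj lin by blast
  then obtain x where x: "\<phi> x = (\<Sum>b\<in>set bs. s (g b) b)"
    by (metis surjD)
  have "F x b = g b" if "b \<in> set bs" for b
    using coord[OF that, of "F x"] coord[OF that, of g] x by (simp add: \<phi>_def)
  then have "F x y = g y" for y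
    by (subst F_eq, subst expand[OF g]) simp
  then show ?thesis by (rule that)
qed

lemma lmap_mult: "lmap g \<Longrightarrow> lmap (\<lambda>x. g x * c)" "lmap g \<Longrightarrow> lmap (\<lambda>x. c * g x)"
  by (auto simp: lmap_iff algebra_simps scale_mult_left scale_mult_right)

end

section \<open>Evaluating forms on coproducts\<close>

context weak_bialgebra
begin

text \<open>For bilinear \<open>F\<close> this is the value of \<open>F\<close> at
  \<open>\<Delta> a\<close>. Nesting it expresses iterated coproducts while all values stay in the
  field.\<close>

definition sw :: "'a \<Rightarrow> ('a \<Rightarrow> 'a \<Rightarrow> 'k) \<Rightarrow> 'k" where
  "sw a F = (\<Sum>(x, y)\<leftarrow>rep (\<Delta> a). F x y)"

lemma tens2_rep_comult: "tens2 s (rep (\<Delta> a)) = \<Delta> a"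
proof -
  obtain xs where "\<Delta> a = tens2 s xs"
    using comult_in[of a] by (auto simp: tensor2_space_def)
  then show ?thesis
    by (metis tensor2_eq_rep tens2_eq_iff)
qed

lemma sw_eq:
  assumes "\<Delta> a = tens2 s xs" "bform F"
  shows "sw a F = (\<Sum>(x, y)\<leftarrow>xs. F x y)"
proof -
  have "tensor2_eq s (rep (\<Delta> a)) xs"
    using assms(1) tens2_rep_comult[of a] tens2_eq_iff[of s "rep (\<Delta> a)" xs] by simp
  then show ?thesis
    unfolding sw_def using assms(2) by (rule bform_sum_cong)
qed

lemma sw_plus: "sw a (\<lambda>x y. F x y + G x y) = sw a F + sw a G"
  by (simp add: sw_def split_def sum_list_addf)

lemma sw_mult_left: "sw a (\<lambda>x y. k * F x y) = k * sw a F"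
  by (simp add: sw_def split_def sum_list_const_mult)

lemma sw_mult_right: "sw a (\<lambda>x y. F x y * k) = sw a F * k"
  by (simp add: sw_def split_def sum_list_mult_const)

lemma sw_zero: "sw a (\<lambda>x y. 0) = 0"
  by (simp add: sw_def split_def)

lemma sw_sum: "sw a (\<lambda>x y. \<Sum>i\<leftarrow>I. F i x y) = (\<Sum>i\<leftarrow>I. sw a (F i))"
  by (induction I) (simp_all add: sw_plus sw_zero)

lemma sw_swap: "sw a (\<lambda>x y. sw b (\<lambda>u v. F x y u v)) = sw b (\<lambda>u v. sw a (\<lambda>x y. F x y u v))"
proof -
  have "sw b (G :: 'a \<Rightarrow> 'a \<Rightarrow> 'k) = (\<Sum>p\<leftarrow>rep (\<Delta> b). G (fst p) (snd p))" for G
    by (simp add: sw_def split_def)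
  then show ?thesis
    by (simp add: sw_sum)
qed

lemma sw_add:
  assumes "bform F"
  shows "sw (a + b) F = sw a F + sw b F"
  by (subst sw_eq[OF comult_add[unfolded tensor2_add_def] assms]) (simp add: sw_def)

lemma sw_scale:
  assumes "bform F"
  shows "sw (s k a) F = k * sw a F"
proof -
  have "F (s k x) y = k * F x y" for x y
    using assms by (simp add: bform_def lform_iff)
  then show ?thesis
    by (subst sw_eq[OF comult_scale[unfolded tensor2_scale_def] assms])
      (simp add: sw_def split_def o_def sum_list_const_mult)
qed

lemma sw_mult:
  assumes "bform F"
  shows "sw (a * b) F = sw a (\<lambda>x y. sw b (\<lambda>u v. F (x * u) (y * v)))"
  by (subst sw_eq[OF comult_mult[unfolded tensor2_mult_def] assms])
    (simp add: sw_def split_def o_def sum_list_map_concat)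

lemma lform_sw: "lmap g \<Longrightarrow> bform F \<Longrightarrow> lform (\<lambda>x. sw (g x) F)"
  by (simp add: lform_iff lmap_iff sw_add sw_scale)

lemma lform_sw_arg:
  assumes "\<And>u v. lform (\<lambda>x. F x u v)"
  shows "lform (\<lambda>x. sw a (\<lambda>u v. F x u v))"
proof -
  have "F (x + y) = (\<lambda>u v. F x u v + F y u v)" "F (s k x) = (\<lambda>u v. k * F x u v)" for x y k
    using assms by (simp_all add: lform_iff fun_eq_iff)
  then show ?thesis
    by (simp add: lform_iff sw_plus sw_mult_left)
qed

lemma sw_comult2:
  assumes "tform F"
  shows "(\<Sum>(x, y, z)\<leftarrow>rep (comult2 s \<Delta> a). F x y z) = sw a (\<lambda>x y. sw x (\<lambda>u v. F u v y))"
  unfolding comult2_def comult_id_def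
  by (subst tform_sum_cong[OF tensor3_eq.sym[OF tensor3_eq_rep] assms])
    (simp add: sw_def split_def o_def sum_list_map_concat)

lemma sw_coassoc:
  assumes "tform F"
  shows "sw a (\<lambda>x y. sw x (\<lambda>u v. F u v y)) = sw a (\<lambda>x y. sw y (\<lambda>u v. F x u v))"
proof -
  have "sw a (\<lambda>x y. sw x (\<lambda>u v. F u v y)) = (\<Sum>(x, y, z)\<leftarrow>rep (comult2 s \<Delta> a). F x y z)"
    by (rule sw_comult2[OF assms, symmetric])
  also have "\<dots> = (\<Sum>(x, y, z)\<leftarrow>rep (id_comult s \<Delta> (\<Delta> a)). F x y z)"
    by (simp add: comult2_def coassoc)
  also have "\<dots> = sw a (\<lambda>x y. sw y (\<lambda>u v. F x u v))"
    unfolding id_comult_def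
    by (subst tform_sum_cong[OF tensor3_eq.sym[OF tensor3_eq_rep] assms])
      (simp add: sw_def split_def o_def sum_list_map_concat)
  finally show ?thesis .
qed

lemma lform_sum_sw:
  assumes "lform f"
  shows "f (\<Sum>(x, y)\<leftarrow>rep (\<Delta> a). g x y) = sw a (\<lambda>x y. f (g x y))"
  using assms by (simp add: lform_sum_list sw_def split_def o_def)

lemma sw_counit:
  assumes "lform f"
  shows "sw a (\<lambda>x y. \<epsilon> x * f y) = f a" "sw a (\<lambda>x y. f x * \<epsilon> y) = f a"
proof -
  have *: "f (s k x) = k * f x" for k x
    using assms by (simp add: lform_iff)
  show "sw a (\<lambda>x y. \<epsilon> x * f y) = f a"
    using lform_sum_sw[OF assms, of "\<lambda>x y. s (\<epsilon> x) y" a] by (simp add: counit_left *)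
  show "sw a (\<lambda>x y. f x * \<epsilon> y) = f a"
    using lform_sum_sw[OF assms, of "\<lambda>x y. s (\<epsilon> y) x" a]
    by (simp add: counit_right * mult.commute)
qed

lemmas form_intros = bformI tformI lform_mult lform_comp[OF counit_linear] lform_sw lform_sw_arg
  lmap_mult lmap_ident

end

section \<open>The antipode\<close>

locale frobenius_weak_bialgebra = weak_bialgebra s \<Delta> \<epsilon>
  for s :: "'k::field \<Rightarrow> 'a::{ring, monoid_mult} \<Rightarrow> 'a"
    and \<Delta> :: "'a \<Rightarrow> 'a tensor2" and \<epsilon> :: "'a \<Rightarrow> 'k" +
  fixes S :: "'a \<Rightarrow> 'a" and l :: "'a \<Rightarrow> 'k"
  assumes anti: "bialgebra_anti_automorphism s \<Delta> S"
    and lform_l: "lform l"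
    and nondeg: "nondegenerate l"
    and frobenius: "(\<Sum>(a1, a2)\<leftarrow>rep (\<Delta> a). s (l (b * a2)) a1) =
      (\<Sum>(b1, b2)\<leftarrow>rep (\<Delta> b). s (l (b2 * a)) (S b1))"
begin

section \<open>The inverse of \<open>S\<close>, and compatibility of \<open>S\<close> with the
  counit\<close>

abbreviation "S' \<equiv> inv S"

lemma lmap_S: "lmap S" and bij_S: "bij S" and S_mult: "S (a * b) = S b * S a"
  using anti by (auto simp: bialgebra_anti_automorphism_def)

lemma S_S' [simp]: "S (S' a) = a" and S'_S [simp]: "S' (S a) = a"
  using bij_S by (simp_all add: bij_is_surj surj_f_inv_f bij_is_inj)

lemma S'_eqI: "S b = a \<Longrightarrow> S' a = b"
  by auto

lemma S'_mult: "S' (a * b) = S' b * S' a"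
  by (rule S'_eqI) (simp add: S_mult)

lemma lmap_S': "lmap S'"
proof -
  have "S' (x + y) = S' x + S' y" for x y
    using lmap_S by (intro S'_eqI) (simp add: lmap_iff)
  moreover have "S' (s k x) = s k (S' x)" for k x
    using lmap_S by (intro S'_eqI) (simp add: lmap_iff)
  ultimately show ?thesis
    by (simp add: lmap_iff)
qed

lemma S_1 [simp]: "S 1 = 1"
proof -
  have "S 1 * a = a" for a
    using S_mult[of "S' a" 1] by simp
  from this[of 1] show ?thesis
    by simp
qed

lemma S'_1 [simp]: "S' 1 = 1"
  by (rule S'_eqI) simp

lemmas intros = form_intros lform_comp[OF lform_l] lmap_comp[OF lmap_S] lmap_comp[OF lmap_S']

lemma sw_S:
  assumes "bform F"
  shows "sw (S a) F = sw a (\<lambda>x y. F (S y) (S x))"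
proof -
  have "\<Delta> (S a) = tens2 s [(S a2, S a1). (a1, a2) \<leftarrow> rep (\<Delta> a)]"
    using anti by (simp add: bialgebra_anti_automorphism_def)
  from sw_eq[OF this assms] show ?thesis
    by (simp add: sw_def split_def o_def)
qed

text \<open>The form \<open>\<epsilon> x * \<epsilon> (S' y)\<close> is evaluated at
  \<open>\<Delta> (S a)\<close> in two ways: by the counit law directly, and after \<open>S\<close>
  has exchanged the legs.\<close>

lemma counit_S [simp]: "\<epsilon> (S a) = \<epsilon> a"
proof -
  have "\<epsilon> a = sw (S a) (\<lambda>x y. \<epsilon> x * \<epsilon> (S' y))"
    by (subst sw_counit) (simp_all add: lform_comp[OF counit_linear] lmap_S')
  also have "\<dots> = sw a (\<lambda>x y. \<epsilon> (S y) * \<epsilon> x)"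
    by (subst sw_S) (intro intros | simp)+
  also have "\<dots> = \<epsilon> (S a)"
    using sw_counit(1)[of "\<lambda>x. \<epsilon> (S x)" a]
    by (simp add: lform_comp[OF counit_linear] lmap_S mult.commute)
  finally show ?thesis by simp
qed

section \<open>The hypothesis on forms, and nondegeneracy as representability\<close>

lemma sw_frobenius:
  assumes "lform f"
  shows "sw a (\<lambda>x y. f x * l (b * y)) = sw b (\<lambda>x y. f (S x) * l (y * a))"
proof -
  have "f (s k x) = k * f x" for k x
    using assms by (simp add: lform_iff)
  then show ?thesis
    using lform_sum_sw[OF assms, of "\<lambda>x y. s (l (b * y)) x" a]
      lform_sum_sw[OF assms, of "\<lambda>x y. s (l (y * a)) (S x)" b] frobenius[of b a]
    by (simp add: mult.commute)
qed

lemma l_eq_zeroD: "(\<And>b. l (b * a) = 0) \<Longrightarrow> a = 0" "(\<And>b. l (a * b) = 0) \<Longrightarrow> a = 0"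
  using nondeg by (auto simp: nondegenerate_def)

lemma l_eqI:
  assumes "\<And>b. l (b * x) = l (b * y)"
  shows "x = y"
proof -
  have "l (b * (x - y)) = 0" for b
  proof -
    have "l (b * x) = l (b * (x - y)) + l (b * y)"
      using lform_l by (metis lform_iff distrib_left diff_add_cancel)
    then show ?thesis
      using assms by simp
  qed
  then show ?thesis
    using l_eq_zeroD(1)[of "x - y"] by simp
qed

lemma lform_eqI:
  assumes "\<And>f. lform f \<Longrightarrow> f x = f y"
  shows "x = y"
  by (intro l_eqI assms intros)

lemma l_represents:
  assumes "lform g"
  obtains b where "\<And>y. l (b * y) = g y"
proof -
  have "bform (\<lambda>x y. l (x * y))"
    by (intro intros)
  from bform_represents[OF this l_eq_zeroD(2) assms] that show thesis
    by blast
qed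

section \<open>The element dual to \<open>l\<close> and its coproduct\<close>

definition r :: 'a where
  "r = (SOME r. \<forall>a. l (a * r) = \<epsilon> a)"

lemma l_r: "l (a * r) = \<epsilon> a"
proof -
  \<comment> \<open>The arguments are exchanged because \<open>r\<close> is to stand on the
    right.\<close>
  have "bform (\<lambda>x y. l (y * x))"
    by (intro intros)
  then obtain r' where "\<And>a. l (a * r') = \<epsilon> a"
    using bform_represents[of "\<lambda>x y. l (y * x)" \<epsilon>] counit_linear l_eq_zeroD(1) by metis
  then have "\<forall>a. l (a * r) = \<epsilon> a"
    unfolding r_def by (intro someI[of "\<lambda>r. \<forall>a. l (a * r) = \<epsilon> a" r']) simp
  then show ?thesis by simp
qed

lemma l_mult_r: "l (a * (b * r)) = \<epsilon> (a * b)"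
  using l_r[of "a * b"] by (simp add: mult.assoc)

text \<open>The hypothesis at \<open>a = r\<close>, where \<open>l (y * r)\<close> becomes
  \<open>\<epsilon> y\<close> and the counit law collapses the coproduct of
  \<open>b\<close>.\<close>

lemma sw_r_S:
  assumes "lform f"
  shows "sw r (\<lambda>x y. f x * l (b * y)) = f (S b)"
  by (simp add: sw_frobenius[OF assms] l_r sw_counit(2)[OF lform_comp[OF assms lmap_S]])

text \<open>Tested against \<open>l (b * _)\<close>, the left side is
  \<open>l (S' (S b) * d)\<close> by \<open>sw_r_S\<close>. So the legs of
  \<open>\<Delta> r\<close>, the first one twisted by \<open>S'\<close>, form the copairing of the
  pairing \<open>l (a * b)\<close>.\<close>

lemma sw_r_dual:
  assumes "lform g"
  shows "sw r (\<lambda>x y. l (S' x * d) * g y) = g d"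
proof -
  define e where "e = (\<Sum>(x, y)\<leftarrow>rep (\<Delta> r). s (l (S' x * d)) y)"
  have e: "f e = sw r (\<lambda>x y. l (S' x * d) * f y)" if "lform f" for f
    unfolding e_def using that by (simp add: lform_sum_sw[OF that]) (simp add: lform_iff)
  have "l (b * e) = l (b * d)" for b
  proof -
    have "lform (\<lambda>y. l (b * y))" "lform (\<lambda>x. l (S' x * d))"
      by (intro intros)+
    from e[OF this(1)] sw_r_S[OF this(2), of b] show ?thesis
      by simp
  qed
  then have "e = d"
    by (rule l_eqI)
  then show ?thesis
    using e[OF assms] by simp
qed

text \<open>Contracting the second leg with \<open>l (b * _)\<close> gives \<open>S (b * a)\<close>
  on one side and \<open>S a * S b\<close> on the other.\<close>

lemma sw_r_slide:
  assumes F: "bform F"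
  shows "sw r (\<lambda>x y. F x (a * y)) = sw r (\<lambda>x y. F (S a * x) y)"
proof -
  obtain bs \<kappa> where bs: "\<And>b. lform (\<kappa> b)" "\<And>x. (\<Sum>b\<leftarrow>bs. s (\<kappa> b x) b) = x"
    using dual_basis by metis
  \<comment> \<open>Each coordinate functional has the form \<open>l (b * _)\<close>, so these
    contractions determine the whole tensor.\<close>
  have "\<exists>b. \<forall>y. l (b * y) = \<kappa> c y" for c
    using l_represents[OF bs(1)] by metis
  then obtain \<beta> where \<beta>: "\<And>c y. l (\<beta> c * y) = \<kappa> c y"
    by metis
  have F_eq: "F x y = (\<Sum>c\<leftarrow>bs. F x c * l (\<beta> c * y))" for x y
  proof -
    have lf: "lform (F x)"
      using F by (simp add: bform_def)
    then have "F x y = F x (\<Sum>c\<leftarrow>bs. s (\<kappa> c y) c)"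
      by (simp add: bs)
    also have "\<dots> = (\<Sum>c\<leftarrow>bs. F x (s (\<kappa> c y) c))"
      by (simp add: lform_sum_list[OF lf] o_def)
    finally show ?thesis
      using lf by (simp add: \<beta> lform_iff mult.commute)
  qed
  have "sw r (\<lambda>x y. F x (a * y)) = (\<Sum>c\<leftarrow>bs. sw r (\<lambda>x y. F x c * l (\<beta> c * (a * y))))"
    by (subst F_eq) (rule sw_sum)
  also have "\<dots> = (\<Sum>c\<leftarrow>bs. F (S a * S (\<beta> c)) c)"
  proof -
    have "sw r (\<lambda>x y. F x c * l (\<beta> c * (a * y))) = F (S (\<beta> c * a)) c" for c
      using sw_r_S[of "\<lambda>x. F x c" "\<beta> c * a"] F by (simp add: bform_def mult.assoc)
    then show ?thesis
      by (simp add: S_mult)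
  qed
  also have "\<dots> = (\<Sum>c\<leftarrow>bs. sw r (\<lambda>x y. F (S a * x) c * l (\<beta> c * y)))"
  proof -
    have "sw r (\<lambda>x y. F (S a * x) c * l (\<beta> c * y)) = F (S a * S (\<beta> c)) c" for c
      by (intro sw_r_S bform_comp[OF F] intros)
    then show ?thesis
      by simp
  qed
  also have "\<dots> = sw r (\<lambda>x y. F (S a * x) y)"
    by (subst (2) F_eq) (rule sw_sum[symmetric])
  finally show ?thesis .
qed

section \<open>The products \<open>S(a\<^sub>1)a\<^sub>2\<close> and
  \<open>a\<^sub>1S(a\<^sub>2)\<close>, and the counit axioms\<close>

text \<open>Writing \<open>S(bc\<^sub>2)\<close> as \<open>r\<^sub>1 l(bc\<^sub>2r\<^sub>2)\<close>
  assembles the left side into the coproduct of \<open>cr\<close>, and the hypothesis transfers it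
  to the coproduct of \<open>b\<close>.\<close>

lemma sw_mult_S_mult_S:
  assumes f: "lform f"
  shows "sw c (\<lambda>x y. f (x * S y * S b)) = sw b (\<lambda>x y. f (S x) * \<epsilon> (y * c))"
proof -
  have "f (x * S y * S b) = sw r (\<lambda>u v. f (x * u) * l (b * (y * v)))" for x y
    using sw_r_S[of "\<lambda>u. f (x * u)" "b * y"] lform_comp[OF f lmap_mult(2)[OF lmap_ident]]
    by (simp add: mult.assoc S_mult)
  then have "sw c (\<lambda>x y. f (x * S y * S b))
      = sw c (\<lambda>x y. sw r (\<lambda>u v. f (x * u) * l (b * (y * v))))"
    by simp
  also have "\<dots> = sw (c * r) (\<lambda>x y. f x * l (b * y))"
    by (rule sw_mult[symmetric]) (intro intros lform_comp[OF f])
  also have "\<dots> = sw b (\<lambda>x y. f (S x) * \<epsilon> (y * c))"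
    by (simp add: sw_frobenius[OF f] l_mult_r)
  finally show ?thesis .
qed

lemma sw_mult_S:
  assumes f: "lform f"
  shows "sw c (\<lambda>x y. f (x * S y)) = sw 1 (\<lambda>x y. f (S x) * \<epsilon> (y * c))"
  using sw_mult_S_mult_S[OF f, of c 1] by simp

text \<open>This is \<open>sw_r_dual\<close> with \<open>r\<close> written as
  \<open>S (S' r)\<close>, which exchanges the legs.\<close>

lemma sw_S'_r:
  assumes f: "lform f"
  shows "sw (S' r) (\<lambda>x y. f (S x) * l (y * a)) = f a"
proof -
  have "f a = sw (S (S' r)) (\<lambda>x y. l (S' x * a) * f y)"
    by (simp add: sw_r_dual[OF f])
  also have "\<dots> = sw (S' r) (\<lambda>x y. f (S x) * l (y * a))"
    by (subst sw_S) (intro intros lform_comp[OF f] | simp add: mult.commute)+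
  finally show ?thesis by simp
qed

text \<open>\<open>S' r\<close> represents the counit from the left, as \<open>r\<close> does from
  the right. The reason is \<open>sw_S'_r\<close> at the counit, which \<open>S\<close>
  preserves.\<close>

lemma l_S'_r_mult: "l (S' r * a) = \<epsilon> a"
proof -
  have "lform (\<lambda>y. l (y * a))"
    by (intro intros)
  then show ?thesis
    using sw_S'_r[OF counit_linear, of a] by (simp add: sw_counit)
qed

text \<open>Since \<open>\<epsilon> (c * y)\<close> is \<open>l (S' r * c * y)\<close>, the
  hypothesis moves the coproduct from \<open>a\<close> to \<open>S' r * c\<close>; the legs of
  \<open>S' r\<close> are then contracted by \<open>sw_S'_r\<close>.\<close>

lemma sw_S_mult_mult:
  assumes f: "lform f"
  shows "sw c (\<lambda>x y. f (S x * y * a)) = sw a (\<lambda>x y. f x * \<epsilon> (c * y))"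
proof -
  have "sw a (\<lambda>x y. f x * \<epsilon> (c * y)) = sw a (\<lambda>x y. f x * l (S' r * c * y))"
    by (simp add: l_S'_r_mult mult.assoc)
  also have "\<dots> = sw (S' r * c) (\<lambda>x y. f (S x) * l (y * a))"
    by (rule sw_frobenius[OF f])
  also have "\<dots> = sw (S' r) (\<lambda>x y. sw c (\<lambda>u v. f (S u * S x) * l (y * (v * a))))"
    by (subst sw_mult) (intro intros lform_comp[OF f] | simp add: S_mult mult.assoc)+
  also have "\<dots> = sw c (\<lambda>u v. sw (S' r) (\<lambda>x y. f (S u * S x) * l (y * (v * a))))"
    by (rule sw_swap)
  also have "\<dots> = sw c (\<lambda>x y. f (S x * y * a))"
  proof -
    have "sw (S' r) (\<lambda>x y. f (S u * S x) * l (y * (v * a))) = f (S u * v * a)" for u v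
      using sw_S'_r[of "\<lambda>x. f (S u * x)" "v * a"] lform_comp[OF f lmap_mult(2)[OF lmap_ident]]
      by (simp add: mult.assoc)
    then show ?thesis by simp
  qed
  finally show ?thesis by simp
qed

lemma sw_S_mult:
  assumes f: "lform f"
  shows "sw c (\<lambda>x y. f (S x * y)) = sw 1 (\<lambda>x y. f x * \<epsilon> (c * y))"
  using sw_S_mult_mult[OF f, of c 1] by simp

lemma counit_sw_S_mult: "sw c (\<lambda>x y. \<epsilon> (S x * y * a)) = \<epsilon> (c * a)"
proof -
  have "lform (\<lambda>y. \<epsilon> (c * y))"
    by (intro intros)
  then show ?thesis
    by (simp add: sw_S_mult_mult[OF counit_linear] sw_counit)
qed

lemma counit_sw_mult_S: "sw c (\<lambda>x y. \<epsilon> (x * S y * S b)) = \<epsilon> (b * c)"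
proof -
  have "lform (\<lambda>y. \<epsilon> (y * c))"
    by (intro intros)
  then show ?thesis
    by (simp add: sw_mult_S_mult_S[OF counit_linear] sw_counit)
qed

text \<open>Apply \<open>\<epsilon> (_ * c)\<close> to
  \<open>S(a\<^sub>1)a\<^sub>2b = b\<^sub>1\<epsilon>(ab\<^sub>2)\<close>; under the counit,
  \<open>S(a\<^sub>1)a\<^sub>2\<close> acts as \<open>a\<close>.\<close>

lemma counit_mult_mult_op: "\<epsilon> (a * b * c) = sw b (\<lambda>x y. \<epsilon> (a * y) * \<epsilon> (x * c))"
proof -
  have "lform (\<lambda>x. \<epsilon> (x * c))"
    by (intro intros)
  from sw_S_mult_mult[OF this, of a b] show ?thesis
    using counit_sw_S_mult[of a "b * c"] by (simp add: mult.assoc mult.commute)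
qed

text \<open>Apply \<open>\<epsilon> (_ * S a)\<close> to \<open>c\<^sub>1S(c\<^sub>2)S(b) =
  S(b\<^sub>1)\<epsilon>(b\<^sub>2c)\<close> and remove \<open>S\<close> under the counit.\<close>

lemma counit_mult_mult: "\<epsilon> (a * b * c) = sw b (\<lambda>x y. \<epsilon> (a * x) * \<epsilon> (y * c))"
proof -
  have eq: "\<epsilon> (S x * S a) = \<epsilon> (a * x)" for x
    by (simp flip: S_mult)
  have "lform (\<lambda>x. \<epsilon> (x * S a))"
    by (intro intros)
  from sw_mult_S_mult_S[OF this, of c b] show ?thesis
    using counit_sw_mult_S[of c "a * b"] by (simp add: S_mult mult.assoc eq)
qed

text \<open>Letting \<open>S(a\<^sub>1)a\<^sub>2\<close> act on \<open>S(a\<^sub>3)\<close> by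
  \<open>sw_S_mult_mult\<close> leaves \<open>\<epsilon>(a\<^sub>1S(a\<^sub>2))S(a\<^sub>3)\<close>,
  and \<open>\<epsilon>(a\<^sub>1S(a\<^sub>2)) = \<epsilon>(a)\<close>.\<close>

lemma sw_S_mult_S:
  assumes f: "lform f"
  shows "sw a (\<lambda>x y. sw x (\<lambda>u v. f (S u * v * S y))) = f (S a)"
proof -
  have "sw a (\<lambda>x y. sw x (\<lambda>u v. f (S u * v * S y)))
      = sw a (\<lambda>x y. sw (S y) (\<lambda>u v. f u * \<epsilon> (x * v)))"
    by (simp add: sw_S_mult_mult[OF f])
  also have "\<dots> = sw a (\<lambda>x y. sw y (\<lambda>u v. f (S v) * \<epsilon> (x * S u)))"
    by (subst sw_S) (intro intros lform_comp[OF f] | simp)+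
  also have "\<dots> = sw a (\<lambda>x y. sw x (\<lambda>u v. f (S y) * \<epsilon> (u * S v)))"
    by (rule sw_coassoc[symmetric]) (intro intros lform_comp[OF f])
  also have "\<dots> = sw a (\<lambda>x y. f (S y) * \<epsilon> x)"
    using counit_sw_mult_S[of _ 1] by (simp add: sw_mult_left)
  also have "\<dots> = f (S a)"
    using sw_counit(1)[OF lform_comp[OF f lmap_S]] by (simp add: mult.commute)
  finally show ?thesis .
qed

section \<open>The dual identities and the axioms on the iterated coproduct of 1\<close>

text \<open>Two evaluations of \<open>l(S'(r\<^sub>1)) r\<^sub>2 \<otimes> ar\<^sub>3\<close>.
  Contracting with \<open>sw_r_dual\<close> at 1 gives the right side; sliding \<open>a\<close> to
  the first leg beforehand gives the left side.\<close>

lemma sw_S_mult_left: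
  assumes G: "bform G"
  shows "sw a (\<lambda>x y. sw x (\<lambda>u v. G (S u * v) y)) = sw 1 (\<lambda>x y. G x (a * y))"
proof -
  let ?h = "\<lambda>x. l (S' x)"
  note lin = intros bform_comp[OF G]
  let ?W = "sw r (\<lambda>x y. sw x (\<lambda>u v. ?h u * G v (a * y)))"
  have "?W = sw r (\<lambda>x y. sw y (\<lambda>u v. ?h x * G u (a * v)))"
    by (rule sw_coassoc) (intro lin)
  also have "\<dots> = sw r (\<lambda>x y. l (S' x * 1) * sw y (\<lambda>u v. G u (a * v)))"
    by (simp add: sw_mult_left)
  also have "\<dots> = sw 1 (\<lambda>x y. G x (a * y))"
    by (rule sw_r_dual) (intro lin)
  finally have 1: "?W = sw 1 (\<lambda>x y. G x (a * y))" .
  have "?W = sw r (\<lambda>x y. sw (S a * x) (\<lambda>u v. ?h u * G v y))"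
    by (rule sw_r_slide) (intro lin)
  \<comment> \<open>\<open>S\<close> reverses the coproduct of \<open>a\<close>, so
    \<open>S q\<close> meets the leg inside \<open>l\<close>; there \<open>S' (S q * u)\<close> is
    \<open>S' u * q\<close>, ready for \<open>sw_r_dual\<close> at \<open>q\<close>.\<close>
  also have "\<dots> = sw r (\<lambda>x y. sw a (\<lambda>p q. sw x (\<lambda>u v. ?h (S q * u) * G (S p * v) y)))"
    by (subst sw_mult, intro lin, subst sw_S) (intro lin | simp)+
  also have "\<dots> = sw a (\<lambda>p q. sw r (\<lambda>x y. sw x (\<lambda>u v. ?h (S q * u) * G (S p * v) y)))"
    by (rule sw_swap)
  also have "\<dots> = sw a (\<lambda>p q. sw q (\<lambda>u v. G (S p * u) v))"
  proof -
    have "sw r (\<lambda>x y. sw x (\<lambda>u v. ?h (S q * u) * G (S p * v) y)) = sw q (\<lambda>u v. G (S p * u) v)"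
      for p q
    proof -
      have "sw r (\<lambda>x y. sw x (\<lambda>u v. ?h (S q * u) * G (S p * v) y))
          = sw r (\<lambda>x y. sw y (\<lambda>u v. ?h (S q * x) * G (S p * u) v))"
        by (rule sw_coassoc) (intro lin)
      also have "\<dots> = sw r (\<lambda>x y. l (S' x * q) * sw y (\<lambda>u v. G (S p * u) v))"
        by (simp add: sw_mult_left S'_mult)
      also have "\<dots> = sw q (\<lambda>u v. G (S p * u) v)"
        by (rule sw_r_dual) (intro lin)
      finally show ?thesis .
    qed
    then show ?thesis by simp
  qed
  also have "\<dots> = sw a (\<lambda>x y. sw x (\<lambda>u v. G (S u * v) y))"
    by (rule sw_coassoc[symmetric]) (intro lin)
  finally show ?thesis
    using 1 by simp
qed

text \<open>Two evaluations of \<open>r\<^sub>1 \<otimes> (ar\<^sub>2)\<^sub>1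
  l((ar\<^sub>2)\<^sub>2)\<close>: after sliding \<open>a\<close> to the first leg, or after
  expanding the coproduct of \<open>ar\<^sub>2\<close>. Both end with \<open>sw_r_S\<close>.\<close>

lemma sw_mult_S_right:
  assumes G: "bform G"
  shows "sw a (\<lambda>x y. sw x (\<lambda>u v. G (S y) (u * S v))) = sw 1 (\<lambda>x y. G (S a * x) y)"
proof -
  note lin = intros bform_comp[OF G]
  let ?Z = "sw r (\<lambda>x y. sw (a * y) (\<lambda>u v. G x u * l v))"
  have "?Z = sw r (\<lambda>x y. sw y (\<lambda>u v. G (S a * x) u * l v))"
    by (rule sw_r_slide) (intro lin)
  also have "\<dots> = sw r (\<lambda>x y. sw x (\<lambda>u v. G (S a * u) v * l y))"
    by (rule sw_coassoc[symmetric]) (intro lin)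
  also have "\<dots> = sw r (\<lambda>x y. sw x (\<lambda>u v. G (S a * u) v) * l (1 * y))"
    by (simp add: sw_mult_right)
  also have "\<dots> = sw (S 1) (\<lambda>u v. G (S a * u) v)"
    by (rule sw_r_S) (intro lin)
  finally have 1: "?Z = sw 1 (\<lambda>x y. G (S a * x) y)" by simp
  have "?Z = sw r (\<lambda>x y. sw a (\<lambda>p q. sw y (\<lambda>u v. G x (p * u) * l (q * v))))"
    by (subst sw_mult) (intro lin | simp)+
  also have "\<dots> = sw a (\<lambda>p q. sw r (\<lambda>x y. sw y (\<lambda>u v. G x (p * u) * l (q * v))))"
    by (rule sw_swap)
  also have "\<dots> = sw a (\<lambda>p q. sw q (\<lambda>u v. G (S v) (p * S u)))"
  proof -
    have "sw r (\<lambda>x y. sw y (\<lambda>u v. G x (p * u) * l (q * v))) = sw q (\<lambda>u v. G (S v) (p * S u))"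
      for p q
    proof -
      have "sw r (\<lambda>x y. sw y (\<lambda>u v. G x (p * u) * l (q * v)))
          = sw r (\<lambda>x y. sw x (\<lambda>u v. G u (p * v) * l (q * y)))"
        by (rule sw_coassoc[symmetric]) (intro lin)
      also have "\<dots> = sw r (\<lambda>x y. sw x (\<lambda>u v. G u (p * v)) * l (q * y))"
        by (simp add: sw_mult_right)
      also have "\<dots> = sw (S q) (\<lambda>u v. G u (p * v))"
        by (rule sw_r_S) (intro lin)
      also have "\<dots> = sw q (\<lambda>u v. G (S v) (p * S u))"
        by (rule sw_S) (intro lin)
      finally show ?thesis .
    qed
    then show ?thesis by simp
  qed
  also have "\<dots> = sw a (\<lambda>x y. sw x (\<lambda>u v. G (S y) (u * S v)))"
    by (rule sw_coassoc[symmetric]) (intro lin)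
  finally show ?thesis
    using 1 by simp
qed

text \<open>Applying \<open>S'\<close> to both legs of \<open>sw_mult_S_right\<close> and exchanging
  them brings it to the shape of \<open>sw_S_mult_left\<close>, with the product by \<open>a\<close>
  on the other side.\<close>

lemma sw_mult_S'_left:
  assumes G: "bform G"
  shows "sw a (\<lambda>x y. sw x (\<lambda>u v. G (v * S' u) y)) = sw 1 (\<lambda>x y. G x (y * a))"
proof -
  note lin = intros bform_comp[OF G]
  have "bform (\<lambda>p q. G (S' q) (S' p))"
    by (intro lin)
  from sw_mult_S_right[OF this, of a]
  have "sw a (\<lambda>x y. sw x (\<lambda>u v. G (v * S' u) y)) = sw 1 (\<lambda>x y. G (S' y) (S' x * a))"
    by (simp add: S'_mult)
  also have "\<dots> = sw (S 1) (\<lambda>x y. G (S' y) (S' x * a))"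
    by simp
  also have "\<dots> = sw 1 (\<lambda>x y. G x (y * a))"
    by (subst sw_S) (intro lin | simp)+
  finally show ?thesis .
qed

text \<open>
  Both halves of the axiom on \<open>\<Delta>\<^sup>2(1)\<close>: if \<open>\<beta>(a\<^sub>1, a\<^sub>2) \<otimes> a\<^sub>3 = 1\<^sub>1 \<otimes> \<mu>(a, 1\<^sub>2)\<close>, then evaluating the
  case \<open>a = 1\<close> at \<open>id \<otimes> \<Delta>\<close> and the case \<open>a = 1'\<^sub>1\<close> at \<open>\<dots> \<otimes> 1'\<^sub>2\<close> gives the same tensor.
\<close>

lemma sw_comult2_one:
  fixes \<beta> \<mu> :: "'a \<Rightarrow> 'a \<Rightarrow> 'a"
  assumes key: "\<And>G a. bform G \<Longrightarrow>
      sw a (\<lambda>x y. sw x (\<lambda>u v. G (\<beta> u v) y)) = sw 1 (\<lambda>x y. G x (\<mu> a y))"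
    and \<mu>: "\<And>y. \<mu> 1 y = y"
    and \<beta>: "\<And>y. lmap (\<lambda>x. \<beta> x y)" "\<And>x. lmap (\<beta> x)"
    and F: "tform F"
  shows "sw 1 (\<lambda>p q. sw 1 (\<lambda>x y. F x (\<mu> p y) q)) = sw 1 (\<lambda>x y. sw x (\<lambda>u v. F u v y))"
proof -
  note lin = intros tform_comp[OF F] \<beta>
  have "bform (\<lambda>x y. F x y q)" for q
    by (intro lin)
  note key[OF this]
  then have "sw 1 (\<lambda>p q. sw 1 (\<lambda>x y. F x (\<mu> p y) q))
      = sw 1 (\<lambda>p q. sw p (\<lambda>x y. sw x (\<lambda>u v. F (\<beta> u v) y q)))"
    by simp
  also have "\<dots> = sw 1 (\<lambda>x y. sw y (\<lambda>p q. sw x (\<lambda>u v. F (\<beta> u v) p q)))"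
    by (rule sw_coassoc) (intro lin)
  also have "\<dots> = sw 1 (\<lambda>x y. sw x (\<lambda>u v. sw y (\<lambda>p q. F (\<beta> u v) p q)))"
    by (subst sw_swap) (rule HOL.refl)
  also have "\<dots> = sw 1 (\<lambda>x y. sw y (\<lambda>p q. F x p q))"
    by (subst key) (intro lin | simp add: \<mu>)+
  also have "\<dots> = sw 1 (\<lambda>x y. sw x (\<lambda>u v. F u v y))"
    by (rule sw_coassoc[OF F, symmetric])
  finally show ?thesis .
qed

text \<open>The left side is the product of \<open>1 \<otimes> \<Delta>(1)\<close> and
  \<open>\<Delta>(1) \<otimes> 1\<close> in this order; \<open>sw_comult2_one_right\<close> treats
  the opposite order.\<close>

lemma sw_comult2_one_left:
  assumes "tform F"
  shows "sw 1 (\<lambda>p q. sw 1 (\<lambda>x y. F x (p * y) q)) = sw 1 (\<lambda>x y. sw x (\<lambda>u v. F u v y))"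
  by (rule sw_comult2_one[where \<beta> = "\<lambda>u v. S u * v" and \<mu> = "\<lambda>a y. a * y", OF _ _ _ _ assms])
    (rule sw_S_mult_left, assumption | simp | intro intros)+

lemma sw_comult2_one_right:
  assumes "tform F"
  shows "sw 1 (\<lambda>p q. sw 1 (\<lambda>x y. F x (y * p) q)) = sw 1 (\<lambda>x y. sw x (\<lambda>u v. F u v y))"
  by (rule sw_comult2_one[where \<beta> = "\<lambda>u v. v * S' u" and \<mu> = "\<lambda>a y. y * a", OF _ _ _ _ assms])
    (rule sw_mult_S'_left, assumption | simp | intro intros)+

section \<open>The remaining antipode axiom\<close>

text \<open>From \<open>sw_mult_S\<close> the left side is
  \<open>\<epsilon>(S(c)1\<^sub>1)1\<^sub>2\<close>, with \<open>S(c)\<close> on the wrong side.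
  Inserting a second copy of \<open>\<Delta>(1)\<close> turns this into
  \<open>\<epsilon>(1\<^sub>1c\<^sub>1S(c\<^sub>2))1\<^sub>2\<close>, where the counit absorbs
  \<open>S(c\<^sub>2)\<close>.\<close>

lemma sw_mult_S_eq_target:
  assumes f: "lform f"
  shows "sw c (\<lambda>x y. f (x * S y)) = sw 1 (\<lambda>x y. \<epsilon> (x * c) * f y)"
proof -
  note lin = intros lform_comp[OF f]
  have target: "sw c (\<lambda>x y. g (x * S y)) = sw 1 (\<lambda>x y. \<epsilon> (S c * x) * g y)" if g: "lform g" for g
  proof -
    have eq: "\<epsilon> (y * c) = \<epsilon> (S c * S y)" for y
      by (simp flip: S_mult)
    have "sw c (\<lambda>x y. g (x * S y)) = sw 1 (\<lambda>x y. \<epsilon> (S c * S y) * g (S x))"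
      by (simp add: sw_mult_S[OF g] eq mult.commute)
    also have "\<dots> = sw (S 1) (\<lambda>x y. \<epsilon> (S c * x) * g y)"
      by (rule sw_S[symmetric]) (intro intros lform_comp[OF g])
    finally show ?thesis by simp
  qed
  \<comment> \<open>The counit axiom splits the value into
    \<open>\<epsilon>(pc\<^sub>1)\<epsilon>(c\<^sub>2S(c\<^sub>3))\<close>, and the second factor is
    \<open>\<epsilon>(c\<^sub>2)\<close>.\<close>
  have counit_target: "sw c (\<lambda>x y. \<epsilon> (p * x * S y)) = \<epsilon> (p * c)" for p
  proof -
    have "sw c (\<lambda>x y. \<epsilon> (p * x * S y))
        = sw c (\<lambda>x y. sw x (\<lambda>u v. \<epsilon> (p * u) * \<epsilon> (v * S y)))"
      by (simp add: counit_mult_mult)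
    also have "\<dots> = sw c (\<lambda>x y. sw y (\<lambda>u v. \<epsilon> (p * x) * \<epsilon> (u * S v)))"
      by (rule sw_coassoc) (intro lin)
    also have "\<dots> = sw c (\<lambda>x y. \<epsilon> (p * x) * \<epsilon> y)"
      using counit_sw_mult_S[of _ 1] by (simp add: sw_mult_left)
    also have "\<dots> = \<epsilon> (p * c)"
      by (rule sw_counit(2)) (intro lin)
    finally show ?thesis .
  qed
  have "sw c (\<lambda>x y. f (x * S y)) = sw 1 (\<lambda>x y. \<epsilon> (S c * x) * f y)"
    by (rule target[OF f])
  \<comment> \<open>The counit law is read backwards to produce the iterated coproduct of 1, which
    then factors through two copies of \<open>\<Delta>(1)\<close>.\<close>
  also have "\<dots> = sw 1 (\<lambda>x y. sw x (\<lambda>u v. \<epsilon> (S c * u) * \<epsilon> v * f y))"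
  proof -
    have "lform (\<lambda>u. \<epsilon> (S c * u))"
      by (intro lin)
    then show ?thesis
      by (simp add: sw_mult_right sw_counit(2))
  qed
  also have "\<dots> = sw 1 (\<lambda>p q. sw 1 (\<lambda>x y. \<epsilon> (S c * x) * \<epsilon> (p * y) * f q))"
    by (rule sw_comult2_one_left[symmetric]) (intro lin)
  also have "\<dots> = sw 1 (\<lambda>p q. sw c (\<lambda>x y. \<epsilon> (p * x * S y)) * f q)"
  proof -
    have "lform (\<lambda>y. \<epsilon> (p * y))" for p
      by (intro lin)
    then have "sw c (\<lambda>x y. \<epsilon> (p * (x * S y))) = sw 1 (\<lambda>x y. \<epsilon> (S c * x) * \<epsilon> (p * y))" for p
      by (rule target)
    then show ?thesis
      by (simp add: sw_mult_right mult.assoc[of _ _ "S _"])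
  qed
  also have "\<dots> = sw 1 (\<lambda>x y. \<epsilon> (x * c) * f y)"
    by (simp add: counit_target)
  finally show ?thesis .
qed

section \<open>From forms back to elements and tensors\<close>

lemma sw_A_eqI:
  assumes "\<And>f. lform f \<Longrightarrow> sw a (\<lambda>x y. f (g x y)) = sw b (\<lambda>x y. f (h x y))"
  shows "(\<Sum>(x, y)\<leftarrow>rep (\<Delta> a). g x y) = (\<Sum>(x, y)\<leftarrow>rep (\<Delta> b). h x y)"
  using assms by (intro lform_eqI) (simp add: lform_sum_sw)

theorem antipode_S: "antipode s \<Delta> \<epsilon> S"
  unfolding antipode_def
proof (intro conjI allI)
  show "lmap S" by (rule lmap_S)
  fix a
  show "(\<Sum>(a1, a2)\<leftarrow>rep (\<Delta> a). a1 * S a2) = (\<Sum>(u1, u2)\<leftarrow>rep (\<Delta> 1). s (\<epsilon> (u1 * a)) u2)"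
    by (rule sw_A_eqI) (simp add: sw_mult_S_eq_target, simp add: lform_iff)
  show "(\<Sum>(a1, a2)\<leftarrow>rep (\<Delta> a). S a1 * a2) = (\<Sum>(u1, u2)\<leftarrow>rep (\<Delta> 1). s (\<epsilon> (a * u2)) u1)"
    by (rule sw_A_eqI) (simp add: sw_S_mult, simp add: lform_iff mult.commute)
  show "(\<Sum>(a1, a2, a3)\<leftarrow>rep (comult2 s \<Delta> a). S a1 * a2 * S a3) = S a"
  proof (rule lform_eqI)
    fix f assume f: "lform f"
    have "tform (\<lambda>x y z. f (S x * y * S z))"
      by (intro intros lform_comp[OF f])
    then have "(\<Sum>(x, y, z)\<leftarrow>rep (comult2 s \<Delta> a). f (S x * y * S z)) = f (S a)"
      by (simp add: sw_comult2 sw_S_mult_S[OF f])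
    then show "f (\<Sum>(a1, a2, a3)\<leftarrow>rep (comult2 s \<Delta> a). S a1 * a2 * S a3) = f (S a)"
      by (simp add: lform_sum_list[OF f] split_def o_def)
  qed
qed

text \<open>\<open>tensor3_mult\<close> works on chosen representatives. Under a trilinear form
  these are replaced by \<open>xs\<close> and \<open>ys\<close> one factor at a time, the other
  being held fixed.\<close>

lemma tensor3_mult_eqI:
  assumes "\<And>F. tform F \<Longrightarrow> (\<Sum>(x, y, z)\<leftarrow>xs. \<Sum>(x', y', z')\<leftarrow>ys. F (x * x') (y * y') (z * z'))
      = sw a (\<lambda>x y. sw x (\<lambda>u v. F u v y))"
  shows "tensor3_mult s (tens3 s xs) (tens3 s ys) = comult2 s \<Delta> a"
proof -
  let ?m = "\<lambda>xs ys. [(x * x', y * y', z * z'). (x, y, z) \<leftarrow> xs, (x', y', z') \<leftarrow> ys]"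
  have sum_m: "(\<Sum>(x, y, z)\<leftarrow>?m xs ys. F x y z)
      = (\<Sum>(x, y, z)\<leftarrow>xs. \<Sum>(x', y', z')\<leftarrow>ys. F (x * x') (y * y') (z * z'))"
    for xs ys :: "('a \<times> 'a \<times> 'a) list" and F :: "'a \<Rightarrow> 'a \<Rightarrow> 'a \<Rightarrow> 'k"
    by (simp add: split_def o_def sum_list_map_concat)
  have "tensor3_eq s (?m (rep (tens3 s xs)) (rep (tens3 s ys)))
      [(u, v, y). (x, y) \<leftarrow> rep (\<Delta> a), (u, v) \<leftarrow> rep (\<Delta> x)]"
  proof (rule tensor3_eqI)
    fix F assume F: "tform F"
    note xs = tensor3_eq.sym[OF tensor3_eq_rep[of s xs]]
    note ys = tensor3_eq.sym[OF tensor3_eq_rep[of s ys]]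
    have "(\<Sum>(x, y, z)\<leftarrow>?m (rep (tens3 s xs)) (rep (tens3 s ys)). F x y z)
        = (\<Sum>(x, y, z)\<leftarrow>rep (tens3 s xs). \<Sum>(x', y', z')\<leftarrow>ys. F (x * x') (y * y') (z * z'))"
    proof -
      have "tform (\<lambda>x' y' z'. F (x * x') (y * y') (z * z'))" for x y z
        by (intro intros tform_comp[OF F])
      from tform_sum_cong[OF ys this] show ?thesis
        by (simp only: sum_m)
    qed
    also have "\<dots> = (\<Sum>(x, y, z)\<leftarrow>xs. \<Sum>(x', y', z')\<leftarrow>ys. F (x * x') (y * y') (z * z'))"
    proof (rule tform_sum_cong[OF xs])
      have "(\<Sum>(x', y', z')\<leftarrow>ys. F (x * x') (y * y') (z * z'))
        = (\<Sum>p\<leftarrow>ys. F (x * fst p) (y * fst (snd p)) (z * snd (snd p)))" for x y z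
        by (simp add: split_def)
      moreover have lf: "lform (\<lambda>x. \<Sum>p\<leftarrow>ys. g x p)"
        if "\<And>p. lform (\<lambda>x. g x p)" for g :: "'a \<Rightarrow> 'a \<times> 'a \<times> 'a \<Rightarrow> 'k"
      proof -
        have "g (x + y) = (\<lambda>p. g x p + g y p)" "g (s k x) = (\<lambda>p. k * g x p)" for x y k
          using that by (simp_all add: lform_iff fun_eq_iff)
        then show ?thesis
          by (simp add: lform_iff sum_list_addf sum_list_const_mult)
      qed
      ultimately show "tform (\<lambda>x y z. \<Sum>(x', y', z')\<leftarrow>ys. F (x * x') (y * y') (z * z'))"
        by (simp only:) (intro intros lf tform_comp[OF F])
    qed
    also have "\<dots> = sw a (\<lambda>x y. sw x (\<lambda>u v. F u v y))"
      by (rule assms[OF F])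
    finally show "(\<Sum>(x, y, z)\<leftarrow>?m (rep (tens3 s xs)) (rep (tens3 s ys)). F x y z)
        = (\<Sum>(x, y, z)\<leftarrow>[(u, v, y). (x, y) \<leftarrow> rep (\<Delta> a), (u, v) \<leftarrow> rep (\<Delta> x)]. F x y z)"
      by (simp add: sw_def split_def o_def sum_list_map_concat)
  qed
  then show ?thesis
    unfolding tensor3_mult_def comult2_def comult_id_def by (simp only: tens3_eq_iff)
qed

theorem bimonoidal: "bimonoidal s \<Delta> \<epsilon>"
proof -
  have "tensor3_mult s (tens3 s [(u, v, 1). (u, v) \<leftarrow> rep (\<Delta> 1)])
      (tens3 s [(1, u, v). (u, v) \<leftarrow> rep (\<Delta> 1)]) = comult2 s \<Delta> 1"
  proof (rule tensor3_mult_eqI)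
    fix F assume F: "tform F"
    \<comment> \<open>Expanding the product sums over the left factor first, hence the exchange of
      the two copies of \<open>\<Delta>(1)\<close>.\<close>
    have "sw 1 (\<lambda>x y. sw 1 (\<lambda>p q. F x (y * p) q)) = sw 1 (\<lambda>x y. sw x (\<lambda>u v. F u v y))"
      by (subst sw_swap) (rule sw_comult2_one_right[OF F])
    then show "(\<Sum>(x, y, z)\<leftarrow>[(u, v, 1). (u, v) \<leftarrow> rep (\<Delta> 1)].
        \<Sum>(x', y', z')\<leftarrow>[(1, u, v). (u, v) \<leftarrow> rep (\<Delta> 1)]. F (x * x') (y * y') (z * z'))
        = sw 1 (\<lambda>x y. sw x (\<lambda>u v. F u v y))"
      by (simp add: sw_def split_def o_def)
  qed
  moreover have "tensor3_mult s (tens3 s [(1, u, v). (u, v) \<leftarrow> rep (\<Delta> 1)])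
      (tens3 s [(u, v, 1). (u, v) \<leftarrow> rep (\<Delta> 1)]) = comult2 s \<Delta> 1"
  proof (rule tensor3_mult_eqI)
    fix F assume F: "tform F"
    show "(\<Sum>(x, y, z)\<leftarrow>[(1, u, v). (u, v) \<leftarrow> rep (\<Delta> 1)].
        \<Sum>(x', y', z')\<leftarrow>[(u, v, 1). (u, v) \<leftarrow> rep (\<Delta> 1)]. F (x * x') (y * y') (z * z'))
        = sw 1 (\<lambda>x y. sw x (\<lambda>u v. F u v y))"
      using sw_comult2_one_left[OF F] by (simp add: sw_def split_def o_def)
  qed
  ultimately show ?thesis
    unfolding bimonoidal_def Let_def
    using counit_mult_mult[unfolded sw_def] counit_mult_mult_op[unfolded sw_def] by simp
qed

end

theorem theorem8p7:
  fixes s :: "'k::field \<Rightarrow> 'a::{ring, monoid_mult} \<Rightarrow> 'a"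
    and \<Delta> :: "'a \<Rightarrow> 'a tensor2"
    and \<epsilon> :: "'a \<Rightarrow> 'k"
    and S :: "'a \<Rightarrow> 'a"
  assumes "weak_bialgebra s \<Delta> \<epsilon>"
    and "bialgebra_anti_automorphism s \<Delta> S"
    and "\<exists>l :: 'a \<Rightarrow> 'k. Vector_Spaces.linear s (*) l \<and> nondegenerate l \<and>
           (\<forall>a b. (\<Sum>(a1, a2) \<leftarrow> rep (\<Delta> a). s (l (b * a2)) a1) =
                  (\<Sum>(b1, b2) \<leftarrow> rep (\<Delta> b). s (l (b2 * a)) (S b1)))"
  shows "antipode s \<Delta> \<epsilon> S \<and> weak_Hopf_algebra s \<Delta> \<epsilon>"
proof -
  from assms(3) obtain l where "Vector_Spaces.linear s (*) l" "nondegenerate l"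
    "\<And>a b. (\<Sum>(a1, a2) \<leftarrow> rep (\<Delta> a). s (l (b * a2)) a1) =
       (\<Sum>(b1, b2) \<leftarrow> rep (\<Delta> b). s (l (b2 * a)) (S b1))"
    by blast
  then interpret frobenius_weak_bialgebra s \<Delta> \<epsilon> S l
    using assms(1,2)
    by (simp add: frobenius_weak_bialgebra_def frobenius_weak_bialgebra_axioms_def)
  show ?thesis
    unfolding weak_Hopf_algebra_def using antipode_S bimonoidal assms(1) by blast
qed

end
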